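(* Let $p$ be a prime, let $\alpha,n\in\mathbb N$ and let $r\in\mathbb Z$. Then for any polynomial $f(x)\in\mathbb Z[x]$ we have $$\operatorname{ord}_p\left(\sum_{k\equiv r\ (\mathrm{mod}\ p^{\alpha})}\binom nk(-1)^kf\left(\frac{k-r}{p^{\alpha}}\right)\right)\ \ge\ \operatorname{ord}_p\left(\left\lfloor\frac n{p^{\alpha}}\right\rfloor!\right).$$
   Context: $\mathbb N=\{0,1,2,\ldots\}$. For a prime $p$ and an integer $m$, $\operatorname{ord}_p(m)=\sup\{a\in\mathbb N: p^a\mid m\}$ (so $\operatorname{ord}_p(0)=+\infty$). The sum is over all integers $k$ with $k\equiv r \pmod{p^\alpha}$, where $\binom nk=0$ if $k<0$ or $k>n$ (so the sum is finite). *)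

theory Defs
  imports
    "HOL-Computational_Algebra.Computational_Algebra"
    "HOL-Number_Theory.Cong"
    "HOL-Library.Extended_Nat"
begin

(* The supremum is taken in enat, so ord_at p 0 = \<infinity>; the library's
   multiplicity p 0 would be 0. *)
definition ord_at :: "nat \<Rightarrow> int \<Rightarrow> enat" where
  "ord_at p m = Sup (enat ` {a. int p ^ a dvd m})"

(* The sum over all integers k congruent to r modulo p ^ \<alpha>, restricted to the
   range 0 \<le> k \<le> n outside which the binomial coefficient vanishes: a sum over
   the infinite residue class would be 0 by convention. The div is exact there. *)
definition binomial_residue_sum :: "nat \<Rightarrow> nat \<Rightarrow> nat \<Rightarrow> int \<Rightarrow> int poly \<Rightarrow> int" where
  "binomial_residue_sum p \<alpha> n r f =
     (\<Sum>k | 0 \<le> k \<and> k \<le> int n \<and> [k = r] (mod int p ^ \<alpha>).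
        int (n choose nat k) * (- 1) ^ nat k * poly f ((k - r) div int p ^ \<alpha>))"

end

theory Submission
  imports Defs
begin

text \<open>
  Put \<open>q = p\<^sup>\<alpha>\<close>. The residue sum is the value at \<open>(1 - X)\<^sup>n\<close> of the linear functional sending
  \<open>X\<^sup>k\<close> to \<open>w k\<close>, where \<open>w k = f ((k - r) / q)\<close> on the residue class and \<open>0\<close> off it. Under this
  functional, multiplication by \<open>1 - X\<^sup>q\<close> amounts, up to sign, to applying the difference operator
  of step \<open>q\<close> to \<open>w\<close>, i.e. the difference operator of step 1 to \<open>f\<close>; its \<open>j\<close>-th iterate takes
  values divisible by \<open>j!\<close>. By Frobenius, \<open>(1 - X)\<^sup>q = (1 - X\<^sup>q) + p g\<close>, so with \<open>m = \<lfloor>n / q\<rfloor>\<close>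
  every term in the binomial expansion of \<open>((1 - X\<^sup>q) + p g)\<^sup>m\<close> contributes a multiple of
  \<open>(m choose j) j! p\<^bsup>m-j\<^esup> = m! p\<^bsup>m-j\<^esup> / (m-j)!\<close>, and \<open>p\<^sup>i / i!\<close> is \<open>p\<close>-integral.
\<close>

section \<open>Iterated finite differences of polynomials\<close>

definition fdiff :: "'a::plus \<Rightarrow> ('a \<Rightarrow> 'b::minus) \<Rightarrow> 'a \<Rightarrow> 'b" where
  "fdiff d w x = w (x + d) - w x"

text \<open>Leibniz rule for differences: the factor \<open>x\<close> has first difference 1 and
  vanishing higher ones, so only two terms survive.\<close>

lemma fdiff_funpow_mult_ident:
  fixes h :: "'a::comm_ring_1 \<Rightarrow> 'a"
  shows "(fdiff 1 ^^ Suc j) (\<lambda>x. x * h x) x =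
    x * (fdiff 1 ^^ Suc j) h x + of_nat (Suc j) * (fdiff 1 ^^ j) h (x + 1)"
proof (induction j arbitrary: x)
  case 0
  show ?case by (simp add: fdiff_def algebra_simps)
next
  case (Suc j)
  have "(fdiff 1 ^^ Suc (Suc j)) (\<lambda>x. x * h x) x =
      (fdiff 1 ^^ Suc j) (\<lambda>x. x * h x) (x + 1) - (fdiff 1 ^^ Suc j) (\<lambda>x. x * h x) x"
    by (simp add: fdiff_def)
  also have "\<dots> = x * (fdiff 1 ^^ Suc (Suc j)) h x + of_nat (Suc (Suc j)) * (fdiff 1 ^^ Suc j) h (x + 1)"
    unfolding Suc.IH by (simp add: fdiff_def algebra_simps)
  finally show ?case .
qed

lemma fdiff_funpow_const_add:
  fixes h :: "'a::plus \<Rightarrow> 'b::ab_group_add"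
  shows "(fdiff d ^^ Suc j) (\<lambda>x. c + h x) = (fdiff d ^^ Suc j) h"
proof -
  have "fdiff d (\<lambda>x. c + h x) = fdiff d h"
    by (simp add: fdiff_def fun_eq_iff)
  then show ?thesis by (simp add: funpow_Suc_right del: funpow.simps)
qed

text \<open>Induction along the Horner form \<open>a + x * f\<close>: a difference kills the
  constant, and the Leibniz rule supplies the factor \<open>Suc i\<close> that completes
  \<open>fact i\<close> to \<open>fact (Suc i)\<close>.\<close>

lemma fact_dvd_fdiff_funpow_poly:
  fixes f :: "'a::{comm_ring_1,semiring_char_0} poly"
  shows "fact j dvd (fdiff 1 ^^ j) (poly f) x"
proof (induction f arbitrary: j x)
  case 0
  have "(fdiff 1 ^^ j) (\<lambda>_. 0) = (\<lambda>_ :: 'a. 0 :: 'a)" for j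
    by (induction j) (auto simp: fdiff_def fun_eq_iff)
  moreover have "poly (0 :: 'a poly) = (\<lambda>_. 0)" by (simp add: fun_eq_iff)
  ultimately show ?case by simp
next
  case (pCons a f)
  show ?case
  proof (cases j)
    case (Suc i)
    have "fact (Suc i) dvd of_nat (Suc i) * (fdiff 1 ^^ i) (poly f) (x + 1)"
      unfolding fact_Suc by (intro mult_dvd_mono dvd_refl pCons.IH)
    moreover have "(fdiff 1 ^^ j) (poly (pCons a f)) x =
        x * (fdiff 1 ^^ Suc i) (poly f) x + of_nat (Suc i) * (fdiff 1 ^^ i) (poly f) (x + 1)"
      unfolding poly_pCons Suc fdiff_funpow_const_add fdiff_funpow_mult_ident ..
    ultimately show ?thesis
      using pCons.IH[of "Suc i" x] unfolding Suc by (metis dvd_add dvd_mult)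
  qed simp
qed

section \<open>Linear functionals on polynomials\<close>

definition coeff_functional :: "(nat \<Rightarrow> 'a::comm_ring_1) \<Rightarrow> 'a poly \<Rightarrow> 'a" where
  "coeff_functional w P = (\<Sum>k\<le>degree P. coeff P k * w k)"

text \<open>Frees the summation range from the degree, so that polynomials of different degrees can
  be compared over a common range.\<close>

lemma coeff_functional_atMost:
  assumes "degree P \<le> N"
  shows "coeff_functional w P = (\<Sum>k\<le>N. coeff P k * w k)"
  unfolding coeff_functional_def
  by (rule sum.mono_neutral_left) (use assms in \<open>auto simp: coeff_eq_0\<close>)

lemma coeff_functional_add:
  "coeff_functional w (P + Q) = coeff_functional w P + coeff_functional w Q"
proof -
  define N where "N = max (degree P) (degree Q)"
  have "degree P \<le> N" "degree Q \<le> N" "degree (P + Q) \<le> N"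
    by (auto simp: N_def intro: degree_add_le)
  then show ?thesis
    by (simp add: coeff_functional_atMost[where N = N] sum.distrib algebra_simps)
qed

lemma coeff_functional_smult: "coeff_functional w (smult c P) = c * coeff_functional w P"
  by (simp add: coeff_functional_atMost[where N = "degree P"] degree_smult_le sum_distrib_left mult.assoc)

lemma coeff_functional_sum:
  "coeff_functional w (\<Sum>i\<in>A. P i) = (\<Sum>i\<in>A. coeff_functional w (P i))"
proof (induction A rule: infinite_finite_induct)
  case (insert x A)
  then show ?case by (simp add: coeff_functional_add)
qed (simp_all add: coeff_functional_def)

lemma coeff_functional_monom_mult:
  "coeff_functional w (monom 1 d * P) = coeff_functional (\<lambda>k. w (k + d)) P"
proof -
  have "degree (monom 1 d * P) \<le> degree P + d"
    by (metis add.commute add_le_cancel_right degree_monom_le degree_mult_le le_trans)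
  then have "coeff_functional w (monom 1 d * P) =
      (\<Sum>k\<le>degree P + d. if k < d then 0 else coeff P (k - d) * w k)"
    by (simp add: coeff_functional_atMost coeff_monom_mult if_distrib[of "\<lambda>x. x * _"] cong: if_cong)
  also have "\<dots> = (\<Sum>k\<in>{d..degree P + d}. coeff P (k - d) * w k)"
    by (rule sum.mono_neutral_cong_right) auto
  also have "\<dots> = (\<Sum>k\<le>degree P. coeff P k * w (k + d))"
    by (rule sum.reindex_bij_witness[of _ "\<lambda>k. k + d" "\<lambda>k. k - d"]) auto
  finally show ?thesis by (simp add: coeff_functional_def)
qed

lemma coeff_functional_one_minus_monom_power_mult:
  "coeff_functional w ((1 - monom 1 d) ^ j * P) = (-1) ^ j * coeff_functional ((fdiff d ^^ j) w) P"
proof (induction j arbitrary: P)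
  case (Suc j)
  have step: "coeff_functional v ((1 - monom 1 d) * P) = - coeff_functional (fdiff d v) P" for v
  proof -
    have "(1 - monom 1 d) * P = P + smult (-1) (monom 1 d * P)"
      by (simp add: algebra_simps)
    then have "coeff_functional v ((1 - monom 1 d) * P) =
        coeff_functional v P - coeff_functional (\<lambda>k. v (k + d)) P"
      by (simp only: coeff_functional_add coeff_functional_smult coeff_functional_monom_mult) simp
    also have "\<dots> = - coeff_functional (fdiff d v) P"
      by (simp add: coeff_functional_def fdiff_def algebra_simps sum_subtractf)
    finally show ?thesis .
  qed
  \<comment> \<open>The extra factor is moved next to \<open>P\<close>, and the induction hypothesis
    is used at \<open>(1 - monom 1 d) * P\<close>.\<close>
  have "(1 - monom 1 d) ^ Suc j * P = (1 - monom 1 d) ^ j * ((1 - monom 1 d) * P)"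
    by (simp add: ac_simps)
  then show ?case by (simp only: Suc.IH step) simp
qed simp

section \<open>The Frobenius congruence modulo \<open>p\<close>\<close>

lemma prime_dvd_frobenius_add:
  fixes x y :: "'a::comm_ring_1"
  assumes "prime p"
  shows "of_nat p dvd (x + y) ^ p - (x ^ p + y ^ p)"
proof -
  have p: "p > 0" using assms by (rule prime_gt_0_nat)
  have "(x + y) ^ p = (\<Sum>k\<le>p. of_nat (p choose k) * x ^ k * y ^ (p - k))"
    by (rule binomial_ring)
  also have "{..p} = insert 0 (insert p {0<..<p})" using p by auto
  finally have "(x + y) ^ p - (x ^ p + y ^ p) =
      (\<Sum>k\<in>{0<..<p}. of_nat (p choose k) * x ^ k * y ^ (p - k))"
    using p by simp
  also have "of_nat p dvd \<dots>"
  proof (rule dvd_sum)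
    fix k assume "k \<in> {0<..<p}"
    then have "p dvd p choose k" using assms by (intro dvd_choose_prime) auto
    then have "of_nat p dvd (of_nat (p choose k) :: 'a)" by (auto simp: dvd_def)
    then show "of_nat p dvd of_nat (p choose k) * x ^ k * y ^ (p - k)" by simp
  qed
  finally show ?thesis .
qed

lemma prime_dvd_frobenius_power_add:
  fixes x y :: "'a::comm_ring_1"
  assumes "prime p"
  shows "of_nat p dvd (x + y) ^ p ^ a - (x ^ p ^ a + y ^ p ^ a)"
proof (induction a)
  case (Suc a)
  define u v where "u = x ^ p ^ a" and "v = y ^ p ^ a"
  from Suc.IH obtain g where g: "(x + y) ^ p ^ a - (u + v) = of_nat p * g"
    unfolding u_def v_def by (elim dvdE)
  have pow: "z ^ p ^ Suc a = (z ^ p ^ a) ^ p" for z :: 'a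
    by (simp add: mult.commute flip: power_mult)
  have eq: "(x + y) ^ p ^ a = (u + v) + of_nat p * g" using g by (simp add: algebra_simps)
  \<comment> \<open>Frobenius is applied twice: first to split off the multiple of \<open>p\<close>,
    whose own \<open>p\<close>-th power remains divisible by \<open>p\<close>, then to
    \<open>u + v\<close>.\<close>
  have "of_nat p dvd ((u + v) + of_nat p * g) ^ p - ((u + v) ^ p + (of_nat p * g) ^ p)"
    by (rule prime_dvd_frobenius_add[OF assms])
  moreover have "of_nat p dvd (u + v) ^ p - (u ^ p + v ^ p)"
    by (rule prime_dvd_frobenius_add[OF assms])
  moreover have "of_nat p dvd (of_nat p * g) ^ p"
    using prime_gt_0_nat[OF assms] by (intro dvd_trans[OF dvd_triv_left dvd_power]) simp
  ultimately have "of_nat p dvd (((u + v) + of_nat p * g) ^ p - ((u + v) ^ p + (of_nat p * g) ^ p))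
      + ((u + v) ^ p - (u ^ p + v ^ p)) + (of_nat p * g) ^ p"
    by (intro dvd_add)
  then show ?case unfolding pow eq by (simp add: u_def v_def algebra_simps)
qed simp

section \<open>The power of \<open>p\<close> in a factorial\<close>

text \<open>One step of Legendre's formula: the multiples of \<open>p\<close> up to \<open>m\<close>
  multiply to \<open>p ^ (m div p) * fact (m div p)\<close>, and \<open>u\<close> collects the
  factors prime to \<open>p\<close>.\<close>

lemma fact_eq_prime_power_mult_fact_div:
  assumes "prime (p::nat)"
  shows "\<exists>u. coprime u p \<and> fact m = p ^ (m div p) * fact (m div p) * u"
proof (induction m)
  case (Suc m)
  then obtain u where u: "coprime u p" "fact m = p ^ (m div p) * fact (m div p) * u" by blast
  show ?case
  proof (cases "p dvd Suc m")
    case True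
    then have d: "Suc m div p = Suc (m div p)"
      using div_Suc[of m p] by (simp add: dvd_eq_mod_eq_0)
    then have "Suc m = p * Suc (m div p)" using True by (metis dvd_mult_div_cancel)
    then have "fact (Suc m) = p * Suc (m div p) * fact m" by (metis fact_Suc of_nat_id)
    then show ?thesis unfolding d u(2) by (intro exI[of _ u]) (simp add: u(1) algebra_simps)
  next
    case False
    then have d: "Suc m div p = m div p"
      using div_Suc[of m p] by (simp add: dvd_eq_mod_eq_0)
    have "coprime (Suc m) p"
      using False assms by (simp add: coprime_commute prime_imp_coprime)
    then have "coprime (Suc m * u) p" using u(1) by (simp only: coprime_mult_left_iff)
    then show ?thesis unfolding d by (intro exI[of _ "Suc m * u"]) (simp add: u(2) algebra_simps)
  qed
qed (auto intro: exI[of _ 1])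

lemma fact_eq_prime_power_mult_coprime:
  assumes "prime (p::nat)"
  shows "\<exists>e u. e \<le> m \<and> coprime u p \<and> fact m = p ^ e * u"
proof (induction m rule: less_induct)
  case (less m)
  show ?case
  proof (cases "m = 0")
    case False
    have p: "p \<ge> 2" using assms by (rule prime_ge_2_nat)
    then have "m div p < m" using False by (intro div_less_dividend) auto
    then obtain e u where e: "e \<le> m div p" "coprime u p" "fact (m div p) = p ^ e * u"
      using less.IH by blast
    obtain v where v: "coprime v p" "fact m = p ^ (m div p) * fact (m div p) * v"
      using fact_eq_prime_power_mult_fact_div[OF assms] by blast
    \<comment> \<open>The exponent for \<open>m\<close> is \<open>m div p + e\<close> with
      \<open>e \<le> m div p\<close>, so \<open>p \<ge> 2\<close> keeps it at most
      \<open>m\<close>.\<close>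
    have "2 * (m div p) \<le> p * (m div p)" using p by simp
    also have "\<dots> \<le> m" by simp
    finally have "m div p + e \<le> m" using e(1) by linarith
    then show ?thesis using e v
      by (intro exI[of _ "m div p + e"] exI[of _ "u * v"]) (simp add: power_add ac_simps)
  qed (auto intro: exI[of _ 0] exI[of _ 1])
qed

text \<open>The \<open>p\<close>-integrality of \<open>p ^ i / fact i\<close> without fractions: the
  part of \<open>fact i\<close> prime to \<open>p\<close> cancels, and its \<open>p\<close>-part
  divides \<open>p ^ i\<close>.\<close>

lemma prime_power_dvd_mult_power_if_dvd_mult_fact:
  fixes X :: int
  assumes "prime p" and "int p ^ a dvd X * fact i"
  shows "int p ^ a dvd X * int p ^ i"
proof -
  obtain e u where e: "e \<le> i" "coprime u p" "fact i = p ^ e * u"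
    using fact_eq_prime_power_mult_coprime[OF assms(1)] by blast
  have "(fact i :: int) = int (fact i)" by simp
  also have "\<dots> = int p ^ e * int u" by (simp add: e(3))
  finally have "int p ^ a dvd (X * int p ^ e) * int u" using assms(2) by (simp add: ac_simps)
  moreover have "coprime (int p ^ a) (int u)" using e(2) by (simp add: coprime_commute)
  ultimately have "int p ^ a dvd X * int p ^ e" by (simp add: coprime_dvd_mult_left_iff)
  then show ?thesis using e(1) by (meson dvd_trans dvd_refl mult_dvd_mono le_imp_power_dvd)
qed

section \<open>Divisibility of the functional, and its application to the residue sum\<close>

text \<open>Only powers of \<open>p\<close> are tracked, since \<open>p ^ i / fact i\<close> is
  integral only at \<open>p\<close>. The free factor \<open>P\<close> leaves room for exponents that
  are not multiples of \<open>p ^ \<alpha>\<close>.\<close>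

lemma prime_power_dvd_coeff_functional:
  fixes w :: "nat \<Rightarrow> int"
  assumes p: "prime p" and w: "\<And>j k. fact j dvd (fdiff (p ^ \<alpha>) ^^ j) w k"
    and a: "int p ^ a dvd fact m"
  shows "int p ^ a dvd coeff_functional w ([:1, -1:] ^ (p ^ \<alpha> * m) * P)"
proof -
  define q where "q = p ^ \<alpha>"
  have X: "([:0, 1:] :: int poly) ^ q = monom 1 q"
    by (simp add: monom_altdef)
  have "of_nat p dvd ([:1, -1:] + [:0, 1:]) ^ p ^ \<alpha> -
      ([:1, -1:] ^ p ^ \<alpha> + ([:0, 1:] :: int poly) ^ p ^ \<alpha>)"
    by (rule prime_dvd_frobenius_power_add[OF p])
  \<comment> \<open>Splitting 1 as \<open>(1 - X) + X\<close> avoids the sign of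
    \<open>(- X) ^ q\<close>, hence a separate case \<open>p = 2\<close>.\<close>
  moreover have "[:1, -1:] + [:0, 1:] = (1 :: int poly)" by simp
  ultimately obtain g :: "int poly" where "1 - ([:1, -1:] ^ q + monom 1 q) = of_nat p * g"
    unfolding q_def[symmetric] X by (metis dvdE power_one)
  then have g: "[:1, -1:] ^ q = (1 - monom 1 q) + of_nat p * (- g)"
    by (simp add: algebra_simps)
  have pow: "(of_nat p * (- g)) ^ k = smult (int p ^ k) ((- g) ^ k)" for k
    unfolding power_mult_distrib of_nat_power[symmetric] by (simp add: of_nat_poly)
  have term_eq: "of_nat c * A * smult d B * C = smult (int c * d) (A * (B * C))"
    for A B C :: "int poly" and c d
    by (simp add: of_nat_poly mult.assoc mult.commute[of d])
  have "[:1, -1:] ^ (q * m) * P = ((1 - monom 1 q) + of_nat p * (- g)) ^ m * P"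
    by (simp add: power_mult g)
  also have "\<dots> = (\<Sum>j\<le>m. smult (int (m choose j) * int p ^ (m - j))
      ((1 - monom 1 q) ^ j * ((- g) ^ (m - j) * P)))"
    unfolding binomial_ring sum_distrib_right pow
    by (intro sum.cong refl term_eq)
  finally have eq: "coeff_functional w ([:1, -1:] ^ (q * m) * P) =
      (\<Sum>j\<le>m. int (m choose j) * int p ^ (m - j) *
        ((-1) ^ j * coeff_functional ((fdiff q ^^ j) w) ((- g) ^ (m - j) * P)))"
    by (simp only: coeff_functional_sum coeff_functional_smult
        coeff_functional_one_minus_monom_power_mult)
  have "int p ^ a dvd int (m choose j) * int p ^ (m - j) *
      ((-1) ^ j * coeff_functional ((fdiff q ^^ j) w) ((- g) ^ (m - j) * P))" if "j \<le> m" for j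
  proof -
    have "fact j * fact (m - j) * (m choose j) = (fact m :: nat)"
      by (rule binomial_fact_lemma[OF that])
    then have "int (fact j * fact (m - j) * (m choose j)) = int (fact m)"
      by (rule arg_cong)
    \<comment> \<open>In this factorization \<open>fact (m - j)\<close> is traded for
      \<open>p ^ (m - j)\<close>; the remaining \<open>fact j\<close> is then supplied by the
      \<open>j\<close>-th difference of \<open>w\<close>.\<close>
    then have "(fact m :: int) = int (m choose j) * fact j * fact (m - j)"
      by (simp add: ac_simps)
    then have "int p ^ a dvd int (m choose j) * fact j * int p ^ (m - j)"
      using a by (intro prime_power_dvd_mult_power_if_dvd_mult_fact[OF p]) simp
    then have "int p ^ a dvd int (m choose j) * int p ^ (m - j) * fact j"
      by (simp only: ac_simps)
    moreover have "fact j dvd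
        (-1) ^ j * coeff_functional ((fdiff q ^^ j) w) ((- g) ^ (m - j) * P)"
      unfolding coeff_functional_def by (intro dvd_mult dvd_sum) (simp add: q_def w)
    ultimately show ?thesis by (meson dvd_trans dvd_refl mult_dvd_mono)
  qed
  then show ?thesis unfolding q_def[symmetric] eq by (intro dvd_sum) auto
qed

text \<open>A shift by \<open>q\<close> preserves the residue class and raises the quotient by 1, so
  differencing commutes with extension by zero.\<close>

lemma fdiff_funpow_residue_class:
  fixes h :: "int \<Rightarrow> 'b::ab_group_add"
  assumes "q > 0"
  shows "(fdiff q ^^ j) (\<lambda>k. if [int k = r] (mod int q) then h ((int k - r) div int q) else 0) =
    (\<lambda>k. if [int k = r] (mod int q) then (fdiff 1 ^^ j) h ((int k - r) div int q) else 0)"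
proof (induction j)
  case (Suc j)
  have "(int (k + q) - r) div int q = (int k - r) div int q + 1" for k
    using assms div_add_self2[of "int q" "int k - r"] by (simp add: algebra_simps)
  moreover have "[int (k + q) = r] (mod int q) \<longleftrightarrow> [int k = r] (mod int q)" for k
    by (simp add: cong_def)
  ultimately show ?case unfolding funpow.simps(2) comp_apply Suc.IH by (auto simp: fdiff_def)
qed (simp cong: if_cong)

lemma binomial_residue_sum_eq_coeff_functional:
  "binomial_residue_sum p \<alpha> n r f = coeff_functional
    (\<lambda>k. if [int k = r] (mod int (p ^ \<alpha>)) then poly f ((int k - r) div int (p ^ \<alpha>)) else 0)
    ([:1, -1:] ^ n)"
proof -
  let ?w = "\<lambda>k. if [int k = r] (mod int (p ^ \<alpha>)) then poly f ((int k - r) div int (p ^ \<alpha>)) else 0"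
  have "degree ([:1, -1 :: int:] ^ n) \<le> n"
    using degree_power_le[of "[:1, -1 :: int:]" n] by simp
  then have "coeff_functional ?w ([:1, -1:] ^ n) = (\<Sum>k\<le>n. int (n choose k) * (-1) ^ k * ?w k)"
    by (auto simp: coeff_functional_atMost[where N = n] coeff_linear_poly_power intro!: sum.cong)
  also have "\<dots> = (\<Sum>k | k \<le> n \<and> [int k = r] (mod int p ^ \<alpha>).
      int (n choose k) * (-1) ^ k * poly f ((int k - r) div int p ^ \<alpha>))"
    by (rule sum.mono_neutral_cong_right) auto
  also have "\<dots> = binomial_residue_sum p \<alpha> n r f"
    unfolding binomial_residue_sum_def
    by (rule sum.reindex_bij_witness[of _ nat int]) auto
  finally show ?thesis ..
qed

theorem theorem1p5:
  fixes p \<alpha> n :: nat and r :: int and f :: "int poly"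
  assumes "prime p"
  shows "ord_at p (binomial_residue_sum p \<alpha> n r f) \<ge> ord_at p (fact (n div p ^ \<alpha>))"
proof -
  define w where
    "w = (\<lambda>k. if [int k = r] (mod int (p ^ \<alpha>)) then poly f ((int k - r) div int (p ^ \<alpha>)) else 0)"
  have q: "p ^ \<alpha> > 0" using prime_gt_0_nat[OF assms] by simp
  have w: "fact j dvd (fdiff (p ^ \<alpha>) ^^ j) w k" for j k
    unfolding w_def fdiff_funpow_residue_class[OF q] by (simp add: fact_dvd_fdiff_funpow_poly)
  \<comment> \<open>The leftover power with exponent \<open>n mod p ^ \<alpha>\<close> plays the
    role of \<open>P\<close>.\<close>
  have "[:1, -1 :: int:] ^ n =
      [:1, -1:] ^ (p ^ \<alpha> * (n div p ^ \<alpha>)) * [:1, -1:] ^ (n mod p ^ \<alpha>)"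
    by (simp flip: power_add)
  then have "int p ^ a dvd binomial_residue_sum p \<alpha> n r f"
    if "int p ^ a dvd fact (n div p ^ \<alpha>)" for a
    using prime_power_dvd_coeff_functional[OF assms w that]
    unfolding binomial_residue_sum_eq_coeff_functional w_def[symmetric] by simp
  then show ?thesis
    \<comment> \<open>Inclusion of the exponent sets gives the inequality of suprema, also when the
      residue sum is 0 and its order infinite.\<close>
    unfolding ord_at_def by (intro Sup_subset_mono image_mono) auto
qed

end
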